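(* Let $I\subseteq\mathbb{R}_+$ be an interval with $\inf I=0$ and let $f\colon I\to\mathbb{R}$ be a twice continuously differentiable function with nowhere vanishing first derivative. Put $\kappa_f(x):=\frac{xf''(x)}{f'(x)}+1$ for $x\in I$ and define $$q:=\liminf_{x\to0^+}\kappa_f(x)\le\limsup_{x\to0^+}\kappa_f(x)=:p .$$ Then, for all $x\in I$, $$C(q)\le\liminf_{n\to\infty}\frac{n}{x}\,\mathscr{A}_f\left(\tfrac{x}{1},\tfrac{x}{2},\dots,\tfrac{x}{n}\right)\le\limsup_{n\to\infty}\frac{n}{x}\,\mathscr{A}_f\left(\tfrac{x}{1},\tfrac{x}{2},\dots,\tfrac{x}{n}\right)\le C(p),$$ and, consequently, $$C(q)\le\mathscr{H}(\mathscr{A}_f).$$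
   Context: $\mathbb{R}_+=(0,\infty)$. For $p\in[-\infty,+\infty]$, $$C(p):=\begin{cases}1 & p=-\infty,\\ (1-p)^{-1/p} & p\in(-\infty,0)\cup(0,1),\\ e & p=0,\\ +\infty & p\in[1,\infty].\end{cases}$$ For an interval $I$ and a continuous, strictly monotone $f\colon I\to\mathbb{R}$, the quasi-arithmetic mean $\mathscr{A}_f\colon\bigcup_{n=1}^\infty I^n\to I$ is $$\mathscr{A}_f(x_1,\dots,x_n):=f^{-1}\left(\frac{f(x_1)+\cdots+f(x_n)}{n}\right).$$ For a mean $M\colon\bigcup_{n=1}^\infty I^n\to I$ on an interval $I$ with $\inf I=0$, the Hardy constant $\mathscr{H}(M)$ is the smallest nonnegative extended real number such that $$\sum_{n=1}^\infty M(x_1,\dots,x_n)\le\mathscr{H}(M)\sum_{n=1}^\infty x_n$$ for all sequences $(x_n)_{n=1}^\infty$ belonging to $I$. The liminf and limsup defining $q$ and $p$ may take values in $[-\infty,+\infty]$. *)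

theory Defs
  imports "HOL-Analysis.Analysis"
begin

definition C_const :: "ereal \<Rightarrow> ereal" where
  "C_const p =
     (if p = -\<infinity> then 1
      else if p \<ge> 1 then \<infinity>
      else if p = 0 then ereal (exp 1)
      else ereal ((1 - real_of_ereal p) powr (- 1 / real_of_ereal p)))"

text \<open>A mean, a function on the union of all \<open>I^n\<close> with \<open>n \<ge> 1\<close>, is encoded as a function
  on lists; only its values at nonempty lists over \<open>I\<close> matter.\<close>

definition quasi_arith_mean :: "real set \<Rightarrow> (real \<Rightarrow> real) \<Rightarrow> real list \<Rightarrow> real" where
  "quasi_arith_mean I f xs =
     the_inv_into I f (sum_list (map f xs) / real (length xs))"

text \<open>Sequences are indexed from 0 here, so the term number \<open>n\<close> of the left-hand series is
  the mean of the first \<open>n + 1\<close> terms of \<open>x\<close>. For \<open>I \<subseteq> {0<..}\<close> and a mean with values in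
  \<open>I\<close>, both series have positive terms and hence a sum in \<open>(0, \<infinity>]\<close>.\<close>

definition hardy_bound :: "real set \<Rightarrow> (real list \<Rightarrow> real) \<Rightarrow> ereal \<Rightarrow> bool" where
  "hardy_bound I M H \<longleftrightarrow>
     0 \<le> H \<and>
     (\<forall>x :: nat \<Rightarrow> real. (\<forall>n. x n \<in> I) \<longrightarrow>
        (\<Sum>n. ereal (M (map x [0..<Suc n]))) \<le> H * (\<Sum>n. ereal (x n)))"

definition hardy_constant :: "real set \<Rightarrow> (real list \<Rightarrow> real) \<Rightarrow> ereal" where
  "hardy_constant I M = Inf {H. hardy_bound I M H}"

text \<open>The infimum is attained, so the Hardy constant is indeed the smallest bound.\<close>

lemma hardy_bound_hardy_constant:
  assumes I: "is_interval I" "I \<noteq> {}" "I \<subseteq> {0<..}" "Inf I = 0"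
    and M_in: "\<And>xs. xs \<noteq> [] \<Longrightarrow> set xs \<subseteq> I \<Longrightarrow> M xs \<in> I"
    and M_single: "\<And>a. a \<in> I \<Longrightarrow> M [a] = a"
  shows "hardy_bound I M (hardy_constant I M)"
proof -
  have M_pos: "M (map x [0..<Suc n]) > 0" if "\<And>n. x n \<in> I" for x n
  proof -
    have "M (map x [0..<Suc n]) \<in> I"
      by (rule M_in) (use that in auto)
    then show ?thesis using I(3) by auto
  qed
  have ge_half: "ereal (1/2) \<le> H" if H: "hardy_bound I M H" for H
  proof -
    obtain a where a: "a \<in> I" using I(2) by auto
    define x where "x n = a * (1/2) ^ n" for n :: nat
    have a0: "a > 0" using a I(3) by auto
    have xI: "x n \<in> I" for n
    proof -
      have "x n > 0" using a0 by (simp add: x_def)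
      then obtain b where b: "b \<in> I" "b < x n"
        using I(2,4) cInf_lessD[of I "x n"] by auto
      have "x n \<le> a"
        using a0 power_le_one[of "1/2::real" n] by (simp add: x_def mult_left_le)
      then show ?thesis
        using mem_is_interval_1_I[OF I(1) b(1) a] b by auto
    qed
    have "(\<lambda>n. x n) sums (a * (1 / (1 - 1/2)))"
      unfolding x_def by (intro sums_mult geometric_sums) auto
    then have "(\<lambda>n. ereal (x n)) sums ereal (a * 2)" by (simp add: sums_ereal)
    then have sum_x: "(\<Sum>n. ereal (x n)) = ereal (a * 2)" by (rule sums_unique[symmetric])
    have M_nn: "0 \<le> ereal (M (map x [0..<Suc n]))" for n
      using M_pos[of x n] xI by (simp del: upt_Suc)
    have "ereal a = (\<Sum>n<1. ereal (M (map x [0..<Suc n])))"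
      using M_single[OF a] by (simp add: x_def)
    also have "\<dots> \<le> (\<Sum>n. ereal (M (map x [0..<Suc n])))"
      by (rule sum_le_suminf) (use M_nn in \<open>auto intro!: summable_ereal_pos simp del: upt_Suc\<close>)
    also have "\<dots> \<le> H * ereal (a * 2)"
      using H xI sum_x unfolding hardy_bound_def by metis
    finally have "ereal a \<le> H * ereal (a * 2)" .
    then show ?thesis using a0 by (cases H) (auto simp: field_simps)
  qed
  have half: "ereal (1/2) \<le> hardy_constant I M"
    unfolding hardy_constant_def by (rule Inf_greatest) (use ge_half in auto)
  then have pos: "0 < hardy_constant I M"
    by (rule less_le_trans[rotated]) simp
  show ?thesis
    unfolding hardy_bound_def
  proof (intro conjI allI impI)
    show "0 \<le> hardy_constant I M" using pos by simp
    fix x :: "nat \<Rightarrow> real"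
    assume x: "\<forall>n. x n \<in> I"
    define S where "S = (\<Sum>n. ereal (x n))"
    have x0: "x n > 0" for n using x I(3) by auto
    have "ereal (x 0) = (\<Sum>n<1. ereal (x n))" by simp
    also have "\<dots> \<le> S" unfolding S_def
      by (rule sum_le_suminf) (use x0 in \<open>auto intro!: summable_ereal_pos simp: less_imp_le\<close>)
    finally have S0: "S > 0" using x0[of 0] by (metis ereal_less(2) less_le_trans)
    let ?T = "\<Sum>n. ereal (M (map x [0..<Suc n]))"
    have T: "?T \<le> H * S" if "hardy_bound I M H" for H
      using that x unfolding hardy_bound_def S_def by blast
    show "?T \<le> hardy_constant I M * (\<Sum>n. ereal (x n))"
    proof (cases "S = \<infinity>")
      case True
      then have "hardy_constant I M * S = \<infinity>" using pos by simp
      then show ?thesis by (simp only: S_def[symmetric] ereal_less_eq(1))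
    next
      case False
      then have fin: "\<bar>S\<bar> \<noteq> \<infinity>" using S0 by auto
      have "?T / S \<le> hardy_constant I M"
        unfolding hardy_constant_def
        by (rule Inf_greatest) (use T S0 fin in \<open>auto simp: ereal_divide_le_pos mult.commute simp del: upt_Suc\<close>)
      then show ?thesis
        using S0 fin by (simp add: ereal_divide_le_pos mult.commute S_def[symmetric] del: upt_Suc)
    qed
  qed
qed

end

theory Submission
  imports Defs "HOL-Real_Asymp.Real_Asymp"
begin

text \<open>
  The function \<open>\<kappa>\<close> measures how \<open>f\<close> compares with power functions: \<open>\<kappa>\<close> is constantly \<open>s\<close> exactly when
  \<open>f\<close> is a nonconstant affine function of \<open>t powr s\<close> (of \<open>ln t\<close> if \<open>s = 0\<close>), in which case \<open>f\<close> generates the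
  \<open>s\<close>-th power mean. For that mean the limit in question is explicit, since
  \<open>(1/n) * (\<Sum>k=1..n. (n/k) powr s)\<close> tends to \<open>1 / (1 - s)\<close> if \<open>s < 1\<close>, and its \<open>s\<close>-th root
  \<open>(1 - s) powr (- 1 / s)\<close> is the value of \<open>C_const\<close>. The theorem says that a one-sided bound on
  \<open>\<kappa>\<close> near 0 gives the same one-sided bound on the limit.

  Replacing \<open>f\<close> by \<open>- f\<close> changes neither the mean nor \<open>\<kappa>\<close>, so \<open>f\<close> may be taken increasing.
  Comparing the mean with \<open>y = \<theta> * x / n\<close> then means comparing the average of the \<open>f (x / k)\<close>
  with \<open>f y\<close>. If \<open>\<kappa> \<ge> s\<close> near 0, then \<open>f' t * t powr (1 - s)\<close> is nondecreasing there, and so \<open>f\<close> lies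
  above the function of the form \<open>a + b * t powr s\<close> which is tangent to it at \<open>y\<close>
  (\<open>power_tangent_bound\<close>); if \<open>\<kappa> \<le> s\<close>, it lies below. Averaging this inequality
  over the points \<open>x / k\<close> reduces the question to the average of the powers, computed in
  \<open>powr_sum_limit\<close>.

  The bound on \<open>\<kappa>\<close> holds only below some \<open>\<delta>\<close>, whereas the first few points \<open>x / k\<close> may lie
  above it. These points are lowered to \<open>x / K < \<delta>\<close>, that is, \<open>k\<close> is replaced by \<open>max k K\<close>. For the lower
  estimate this only decreases the mean. For the upper estimate it costs a constant \<open>D\<close> in the
  sum, which is absorbed because the gain from \<open>\<theta> > C\<close> is a fixed multiple of \<open>n * y * f' y\<close>, which
  grows at least like \<open>n powr (1 - s)\<close>.

  Letting \<open>s\<close> tend to the lower or upper limit of \<open>\<kappa>\<close> gives the two asymptotic bounds. Only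
  nonzero real \<open>s < 1\<close> are ever used: the remaining values of \<open>C_const\<close> are limits of these.
  The Hardy constant dominates the lower limit because the harmonic series diverges: on the
  sequence \<open>x / 1, \<dots>, x / m\<close>, continued by a summable tail, the terms add up to about
  \<open>x * ln m\<close>, and the means to at least about this times any number below the lower limit.
\<close>

section \<open>The Hardy constants of the power means\<close>

text \<open>The limit of the normalized \<open>s\<close>-th power means of the harmonic sequence, for nonzero \<open>s < 1\<close>;
  it agrees there with \<open>C_const\<close>.\<close>

definition power_mean_const :: "real \<Rightarrow> real" where
  "power_mean_const s = (1 - s) powr (- 1 / s)"

lemma power_mean_const_pos: "s < 1 \<Longrightarrow> 0 < power_mean_const s"
  by (simp add: power_mean_const_def)

text \<open>The quantity bounded here is the limit of the average of \<open>((t / y) powr r - 1) / r\<close> over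
  the points \<open>t = x / k\<close>, for \<open>y = \<theta> * x / n\<close>. Dividing by \<open>r\<close> compensates for the change of
  monotonicity of powers with the sign of \<open>r\<close>.\<close>

lemma power_mean_const_left:
  assumes "r < 1" "r \<noteq> 0" "0 < \<theta>" "\<theta> < power_mean_const r"
  shows "0 < (\<theta> powr (- r) / (1 - r) - 1) / r"
proof -
  have eq: "power_mean_const r powr (- r) = 1 - r"
    using assms by (simp add: power_mean_const_def powr_powr)
  show ?thesis
  proof (cases "r > 0")
    case True
    then have "1 - r < \<theta> powr (- r)"
      using powr_less_mono2_neg[of "- r" \<theta> "power_mean_const r"] assms eq by simp
    then show ?thesis using True assms by (simp add: field_simps)
  next
    case False
    then have "\<theta> powr (- r) < 1 - r"
      using powr_less_mono2[of "- r" \<theta> "power_mean_const r"] assms eq by simp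
    then show ?thesis using False assms by (intro divide_neg_neg) (simp_all add: field_simps)
  qed
qed

lemma power_mean_const_right:
  assumes "s < 1" "s \<noteq> 0" "power_mean_const s < \<theta>"
  shows "(\<theta> powr (- s) / (1 - s) - 1) / s < 0"
proof -
  note pos = power_mean_const_pos[OF assms(1)]
  have eq: "power_mean_const s powr (- s) = 1 - s"
    using assms by (simp add: power_mean_const_def powr_powr)
  show ?thesis
  proof (cases "s > 0")
    case True
    then have "\<theta> powr (- s) < 1 - s"
      using powr_less_mono2_neg[of "- s" "power_mean_const s" \<theta>] assms eq pos by simp
    then show ?thesis using True assms by (simp add: field_simps)
  next
    case False
    then have "1 - s < \<theta> powr (- s)"
      using powr_less_mono2[of "- s" "power_mean_const s" \<theta>] assms eq pos by simp
    then show ?thesis using False assms by (intro divide_pos_neg) (simp_all add: field_simps)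
  qed
qed

lemma isCont_power_mean_const: "s < 1 \<Longrightarrow> s \<noteq> 0 \<Longrightarrow> isCont power_mean_const s"
  unfolding power_mean_const_def by (intro continuous_intros) auto

lemma power_mean_const_limits:
  shows "(power_mean_const \<longlongrightarrow> exp 1) (at 0)"
    and "LIM s at_left 1. power_mean_const s :> at_top"
    and "(power_mean_const \<longlongrightarrow> 1) at_bot"
proof -
  have l: "(power_mean_const \<longlongrightarrow> exp 1) (at_left 0)" "(power_mean_const \<longlongrightarrow> exp 1) (at_right 0)"
    unfolding power_mean_const_def by real_asymp+
  then show "(power_mean_const \<longlongrightarrow> exp 1) (at 0)"
    by (simp add: filterlim_at_split)
  show "LIM s at_left 1. power_mean_const s :> at_top"
    unfolding power_mean_const_def by real_asymp
  show "(power_mean_const \<longlongrightarrow> 1) at_bot"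
    unfolding power_mean_const_def by real_asymp
qed

text \<open>The constant \<open>C_const q\<close> is the limit of \<open>power_mean_const\<close> from the left at \<open>q\<close>, or at 1 if
  \<open>q\<close> is larger. At \<open>q = -\<infinity>\<close> there is no room on the left, but there \<open>C_const q = 1\<close>, a value
  excluded by \<open>1 \<le> \<theta>\<close>.\<close>

lemma less_C_constD:
  assumes "ereal \<theta> < C_const q" "1 \<le> \<theta>"
  shows "\<exists>r. r < 1 \<and> r \<noteq> 0 \<and> ereal r < q \<and> \<theta> < power_mean_const r"
proof -
  have q: "q \<noteq> -\<infinity>" using assms by (auto simp: C_const_def one_ereal_def)
  show ?thesis
  proof (cases "q \<ge> 1")
    case True
    have "eventually (\<lambda>r. \<theta> < power_mean_const r) (at_left 1)"
      using power_mean_const_limits(2) by (simp add: filterlim_at_top_dense)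
    moreover have "eventually (\<lambda>r::real. r \<in> {0<..<1}) (at_left 1)"
      by (rule eventually_at_left_real) simp
    ultimately have "eventually (\<lambda>r. r \<in> {0<..<1} \<and> \<theta> < power_mean_const r) (at_left 1)"
      by eventually_elim simp
    then obtain r where "r \<in> {0<..<1}" "\<theta> < power_mean_const r"
      using eventually_happens trivial_limit_at_left_real by blast
    moreover have "ereal r < q"
      using True calculation(1) by (intro less_le_trans[OF _ True]) (simp add: one_ereal_def)
    ultimately show ?thesis by (intro exI[of _ r]) auto
  next
    case False
    then obtain c where c: "q = ereal c" "c < 1"
      using q by (cases q) (auto simp: one_ereal_def)
    have "\<exists>L. (power_mean_const \<longlongrightarrow> L) (at_left c) \<and> \<theta> < L"
    proof (cases "c = 0")
      case True
      then show ?thesis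
        using assms c power_mean_const_limits(1) unfolding C_const_def
        by (auto simp: filterlim_at_split zero_ereal_def one_ereal_def intro!: exI[of _ "exp 1"])
    next
      case False
      then show ?thesis
        using assms c isCont_power_mean_const[of c]
        by (auto simp: C_const_def isCont_def filterlim_at_split one_ereal_def zero_ereal_def
            power_mean_const_def intro!: exI[of _ "power_mean_const c"])
    qed
    then have "eventually (\<lambda>r. \<theta> < power_mean_const r) (at_left c)"
      by (metis order_tendstoD(1))
    moreover have "eventually (\<lambda>r::real. r \<in> {(if c > 0 then 0 else c - 1)<..<c}) (at_left c)"
      by (rule eventually_at_left_real) simp
    ultimately have "eventually (\<lambda>r. r < c \<and> r \<noteq> 0 \<and> \<theta> < power_mean_const r) (at_left c)"
      by eventually_elim (auto split: if_splits)
    then obtain r where "r < c" "r \<noteq> 0" "\<theta> < power_mean_const r"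
      using eventually_happens trivial_limit_at_left_real by blast
    then show ?thesis using c by (intro exI[of _ r]) auto
  qed
qed

lemma C_const_lessD:
  assumes "C_const p < ereal \<theta>"
  shows "\<exists>s. s < 1 \<and> s \<noteq> 0 \<and> p < ereal s \<and> power_mean_const s < \<theta>"
proof (cases "p = -\<infinity>")
  case True
  then have "1 < \<theta>" using assms by (auto simp: C_const_def one_ereal_def)
  then have "eventually (\<lambda>s. power_mean_const s < \<theta>) at_bot"
    using power_mean_const_limits(3) by (rule order_tendstoD(2)[rotated])
  then have "eventually (\<lambda>s. s < 0 \<and> power_mean_const s < \<theta>) at_bot"
    using eventually_le_at_bot[of "- 1::real"] by eventually_elim simp
  then obtain s where "s < 0" "power_mean_const s < \<theta>"
    using eventually_happens trivial_limit_at_bot_linorder by blast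
  then show ?thesis using True by (intro exI[of _ s]) auto
next
  case False
  then obtain c where c: "p = ereal c" "c < 1"
    using assms by (cases p) (auto simp: C_const_def one_ereal_def split: if_splits)
  have "\<exists>L. (power_mean_const \<longlongrightarrow> L) (at_right c) \<and> L < \<theta>"
  proof (cases "c = 0")
    case True
    then show ?thesis
      using assms c power_mean_const_limits(1) unfolding C_const_def
      by (auto simp: filterlim_at_split zero_ereal_def one_ereal_def intro!: exI[of _ "exp 1"])
  next
    case False
    then show ?thesis
      using assms c isCont_power_mean_const[of c]
      by (auto simp: C_const_def isCont_def filterlim_at_split one_ereal_def zero_ereal_def
          power_mean_const_def intro!: exI[of _ "power_mean_const c"])
  qed
  then have "eventually (\<lambda>s. power_mean_const s < \<theta>) (at_right c)"
    by (metis order_tendstoD(2))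
  moreover have "eventually (\<lambda>s::real. s \<in> {c<..<(if c < 0 then 0 else 1)}) (at_right c)"
    by (rule eventually_at_right_real) (use c in simp)
  ultimately have "eventually (\<lambda>s. c < s \<and> s < 1 \<and> s \<noteq> 0 \<and> power_mean_const s < \<theta>) (at_right c)"
    by eventually_elim (auto split: if_splits)
  then obtain s where "c < s" "s < 1" "s \<noteq> 0" "power_mean_const s < \<theta>"
    using eventually_happens trivial_limit_at_right_real by blast
  then show ?thesis using c by (intro exI[of _ s]) auto
qed

section \<open>Averages of powers over the harmonic sequence\<close>

text \<open>The sum and the integral \<open>G\<close> of the same monotone function advance by comparable amounts in
  each step, and the error telescopes: up to the boundary term \<open>G 1\<close>, it stays between the
  first and the last summand.\<close>

lemma powr_sum_integral_bound:
  assumes "s < 1" "1 \<le> n"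
  shows "\<bar>(\<Sum>k=1..n. real k powr (- s)) - real n powr (1 - s) / (1 - s)\<bar>
           \<le> 1 / (1 - s) + 1 + real n powr (- s)"
proof -
  define G where "G u = u powr (1 - s) / (1 - s)" for u :: real
  define E where "E n = (\<Sum>k=1..n. real k powr (- s)) - G (real n) + G 1" for n
  have E1: "E (Suc 0) = 1" by (simp add: E_def)
  have step: "\<exists>\<xi>. real n < \<xi> \<and> \<xi> < real (Suc n) \<and> E (Suc n) = E n + real (Suc n) powr (- s) - \<xi> powr (- s)"
    if "1 \<le> n" for n
  proof -
    have "\<exists>\<xi>. real n < \<xi> \<and> \<xi> < real (Suc n) \<and> G (real (Suc n)) - G (real n) = (real (Suc n) - real n) * \<xi> powr (- s)"
    proof (rule MVT2)
      fix u assume "real n \<le> u" "u \<le> real (Suc n)"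
      then show "(G has_real_derivative u powr (- s)) (at u)"
        unfolding G_def using that assms(1) by (auto intro!: derivative_eq_intros)
    qed simp
    then show ?thesis by (auto simp: E_def)
  qed
  have "min 1 (real n powr (- s)) \<le> E n \<and> E n \<le> max 1 (real n powr (- s))"
  proof (cases "0 \<le> s")
    case True
    have "real n powr (- s) \<le> E n \<and> E n \<le> 1"
      using assms(2)
    proof (induction n rule: dec_induct)
      case (step n)
      then obtain \<xi> where \<xi>: "real n < \<xi>" "\<xi> < real (Suc n)"
        "E (Suc n) = E n + real (Suc n) powr (- s) - \<xi> powr (- s)"
        using \<open>\<And>n. 1 \<le> n \<Longrightarrow> _\<close> by blast
      have "\<xi> powr (- s) \<le> real n powr (- s)" "real (Suc n) powr (- s) \<le> \<xi> powr (- s)"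
        using True \<xi> step(1) by (intro powr_mono2'; simp)+
      then show ?case using step.IH \<xi>(3) by linarith
    qed (simp add: E1)
    then show ?thesis by linarith
  next
    case False
    have "1 \<le> E n \<and> E n \<le> real n powr (- s)"
      using assms(2)
    proof (induction n rule: dec_induct)
      case (step n)
      then obtain \<xi> where \<xi>: "real n < \<xi>" "\<xi> < real (Suc n)"
        "E (Suc n) = E n + real (Suc n) powr (- s) - \<xi> powr (- s)"
        using \<open>\<And>n. 1 \<le> n \<Longrightarrow> _\<close> by blast
      have "real n powr (- s) \<le> \<xi> powr (- s)" "\<xi> powr (- s) \<le> real (Suc n) powr (- s)"
        using False \<xi> step(1) by (intro powr_mono2; simp)+
      then show ?case using step.IH \<xi>(3) by linarith
    qed (simp add: E1)
    then show ?thesis by linarith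
  qed
  moreover have "0 \<le> real n powr (- s)" "G 1 = 1 / (1 - s)" "0 \<le> 1 / (1 - s)"
    using assms by (simp_all add: G_def)
  ultimately have "\<bar>(\<Sum>k=1..n. real k powr (- s)) - G (real n)\<bar> \<le> 1 / (1 - s) + 1 + real n powr (- s)"
    unfolding E_def by linarith
  then show ?thesis by (simp add: G_def)
qed

lemma powr_sum_limit:
  assumes "s < 1"
  shows "(\<lambda>n. real n powr (s - 1) * (\<Sum>k=1..n. real k powr (- s))) \<longlonglongrightarrow> 1 / (1 - s)"
proof (rule Lim_transform)
  show "(\<lambda>n. real n powr (s - 1) * (real n powr (1 - s) / (1 - s))) \<longlonglongrightarrow> 1 / (1 - s)"
  proof (rule tendsto_eventually)
    show "\<forall>\<^sub>F n in sequentially. real n powr (s - 1) * (real n powr (1 - s) / (1 - s)) = 1 / (1 - s)"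
      using eventually_gt_at_top[of 0]
      by eventually_elim (simp add: powr_add[symmetric])
  qed
  let ?B = "\<lambda>n. real n powr (s - 1) * (1 / (1 - s) + 1 + real n powr (- s))"
  have "((\<lambda>n. real n powr (s - 1)) \<longlongrightarrow> 0) sequentially"
    using assms by real_asymp
  then have "(\<lambda>n. real n powr (s - 1) * (1 / (1 - s) + 1) + 1 / real n) \<longlonglongrightarrow> 0 * (1 / (1 - s) + 1) + 0"
    by (intro tendsto_intros lim_1_over_n)
  moreover have "\<forall>\<^sub>F n in sequentially. real n powr (s - 1) * (1 / (1 - s) + 1) + 1 / real n = ?B n"
    using eventually_gt_at_top[of 0]
  proof eventually_elim
    case (elim n)
    have "real n powr (s - 1) * real n powr (- s) = 1 / real n"
      using elim powr_add[of "real n" "s - 1" "- s"] powr_minus_divide[of "real n" 1] by simp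
    then show ?case by (metis distrib_left)
  qed
  ultimately have B: "?B \<longlonglongrightarrow> 0"
    using tendsto_cong by fastforce
  show "(\<lambda>n. real n powr (s - 1) * (\<Sum>k=1..n. real k powr (- s))
          - real n powr (s - 1) * (real n powr (1 - s) / (1 - s))) \<longlonglongrightarrow> 0"
  proof (rule Lim_null_comparison[OF _ B])
    show "\<forall>\<^sub>F n in sequentially. norm (real n powr (s - 1) * (\<Sum>k=1..n. real k powr (- s))
          - real n powr (s - 1) * (real n powr (1 - s) / (1 - s))) \<le> ?B n"
      using eventually_ge_at_top[of 1]
    proof eventually_elim
      case (elim n)
      have "norm (real n powr (s - 1) * (\<Sum>k=1..n. real k powr (- s))
          - real n powr (s - 1) * (real n powr (1 - s) / (1 - s)))
        = real n powr (s - 1) * \<bar>(\<Sum>k=1..n. real k powr (- s)) - real n powr (1 - s) / (1 - s)\<bar>"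
        unfolding right_diff_distrib[symmetric] by (simp add: abs_mult)
      then show ?case
        using powr_sum_integral_bound[OF assms elim] by (simp add: mult_left_mono)
    qed
  qed
qed

text \<open>Capping changes the sum by a constant, which the factor \<open>n powr (s - 1)\<close> removes in the
  limit.\<close>

lemma capped_powr_sum_limit:
  assumes "s < 1"
  shows "(\<lambda>n. real n powr (s - 1) * (\<Sum>k=1..n. real (max k K) powr (- s))) \<longlonglongrightarrow> 1 / (1 - s)"
proof -
  define D where "D = (\<Sum>k=1..K. real (max k K) powr (- s) - real k powr (- s))"
  have "((\<lambda>n. real n powr (s - 1)) \<longlongrightarrow> 0) sequentially"
    using assms by real_asymp
  then have "(\<lambda>n. real n powr (s - 1) * (\<Sum>k=1..n. real k powr (- s)) + real n powr (s - 1) * D) \<longlonglongrightarrow> 1 / (1 - s) + 0 * D"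
    by (intro tendsto_intros powr_sum_limit assms)
  moreover have "\<forall>\<^sub>F n in sequentially. real n powr (s - 1) * (\<Sum>k=1..n. real k powr (- s)) + real n powr (s - 1) * D
     = real n powr (s - 1) * (\<Sum>k=1..n. real (max k K) powr (- s))"
    using eventually_ge_at_top[of K]
  proof eventually_elim
    case (elim n)
    have "(\<Sum>k=1..n. real (max k K) powr (- s)) - (\<Sum>k=1..n. real k powr (- s)) = D"
      unfolding D_def sum_subtractf[symmetric]
      by (rule sum.mono_neutral_right) (use elim in \<open>auto simp: max_def\<close>)
    then show ?case by (simp add: algebra_simps)
  qed
  ultimately show ?thesis using tendsto_cong by fastforce
qed

section \<open>Tangents among power functions\<close>

text \<open>By the product rule the curvature assumption says that \<open>f' t * t powr (1 - s)\<close>, the derivative of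
  \<open>f\<close> with respect to \<open>t powr s / s\<close>, is nondecreasing; in other words, \<open>f\<close> is convex as a function
  of \<open>t powr s / s\<close>. No sign is imposed on \<open>f'\<close>, so that \<open>- f\<close> can be inserted to obtain
  the reverse inequalities.\<close>

context
  fixes f f' f'' :: "real \<Rightarrow> real" and J :: "real set" and s :: real
  assumes J: "is_interval J" "J \<subseteq> {0<..}"
    and f: "\<And>t. t \<in> J \<Longrightarrow> (f has_real_derivative f' t) (at t)"
    and f': "\<And>t. t \<in> J \<Longrightarrow> (f' has_real_derivative f'' t) (at t)"
    and curv: "\<And>t. t \<in> J \<Longrightarrow> 0 \<le> t * f'' t + (1 - s) * f' t"
begin

lemma relative_deriv_mono:
  assumes y: "y \<in> J" and t: "t \<in> J" and "y \<le> t"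
  shows "f' y * y powr (1 - s) \<le> f' t * t powr (1 - s)"
proof (rule DERIV_nonneg_imp_nondecreasing[OF \<open>y \<le> t\<close>])
  fix u assume "y \<le> u" "u \<le> t"
  then have u: "u \<in> J" using mem_is_interval_1_I[OF J(1) y t] by simp
  then have u0: "u > 0" using J(2) by auto
  have "((\<lambda>u. f' u * u powr (1 - s)) has_real_derivative u powr (- s) * (u * f'' u + (1 - s) * f' u)) (at u)"
  proof (rule DERIV_cong[OF DERIV_mult[OF f'[OF u] has_real_derivative_powr[OF u0]]])
    have "u powr (1 - s) = u * u powr (- s)"
      using u0 powr_add[of u 1 "- s"] by simp
    then show "f'' u * u powr (1 - s) + (1 - s) * u powr (1 - s - 1) * f' u
        = u powr (- s) * (u * f'' u + (1 - s) * f' u)"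
      by (simp add: algebra_simps)
  qed
  then show "\<exists>d. ((\<lambda>u. f' u * u powr (1 - s)) has_real_derivative d) (at u) \<and> 0 \<le> d"
    using mult_nonneg_nonneg[OF powr_ge_zero curv[OF u]] by blast
qed

text \<open>This is the tangent inequality for that convex function: the difference \<open>\<phi>\<close> of both sides
  decreases before \<open>y\<close> and increases after it.\<close>

lemma power_tangent_bound:
  assumes s: "s \<noteq> 0" and y: "y \<in> J" and t: "t \<in> J"
  shows "f y + f' y * y * (((t / y) powr s - 1) / s) \<le> f t"
proof -
  define m where "m = f' y * y powr (1 - s)"
  define \<phi> where "\<phi> u = f u - m * (u powr s / s)" for u
  have pos: "y > 0" "t > 0" using J(2) y t by auto
  have deriv: "(\<phi> has_real_derivative u powr (s - 1) * (f' u * u powr (1 - s) - m)) (at u)"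
    if u: "u \<in> J" for u
  proof -
    have "u > 0" using J(2) u by auto
    then have "u powr (s - 1) * u powr (1 - s) = 1"
      by (simp add: powr_add[symmetric])
    then have "u powr (s - 1) * (f' u * u powr (1 - s)) = f' u"
      by (simp add: mult.left_commute)
    moreover have "(\<phi> has_real_derivative f' u - m * u powr (s - 1)) (at u)"
      unfolding \<phi>_def using f[OF u] \<open>u > 0\<close> s by (auto intro!: derivative_eq_intros)
    ultimately show ?thesis unfolding right_diff_distrib by (simp only: mult.commute)
  qed
  have "\<phi> y \<le> \<phi> t"
  proof (cases "y \<le> t")
    case True
    show ?thesis
    proof (rule DERIV_nonneg_imp_nondecreasing[OF True])
      fix u assume u: "y \<le> u" "u \<le> t"
      then have "u \<in> J" using mem_is_interval_1_I[OF J(1) y t] by simp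
      then show "\<exists>d. (\<phi> has_real_derivative d) (at u) \<and> 0 \<le> d"
        using deriv relative_deriv_mono[OF y _ u(1)] by (intro exI conjI) (auto simp: m_def)
    qed
  next
    case False
    then have "t \<le> y" by simp
    then show ?thesis
    proof (rule DERIV_nonpos_imp_nonincreasing)
      fix u assume u: "t \<le> u" "u \<le> y"
      then have "u \<in> J" using mem_is_interval_1_I[OF J(1) t y] by simp
      then show "\<exists>d. (\<phi> has_real_derivative d) (at u) \<and> d \<le> 0"
        using deriv relative_deriv_mono[OF _ y u(2)]
        by (intro exI conjI) (auto simp: m_def mult_nonneg_nonpos)
    qed
  qed
  moreover have "m * (t powr s / s) - m * (y powr s / s) = f' y * y * (((t / y) powr s - 1) / s)"
    using pos s by (simp add: m_def powr_divide powr_diff field_simps)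
  ultimately show ?thesis by (simp add: \<phi>_def)
qed

end

section \<open>Quasi-arithmetic means with increasing generators\<close>

definition harmonic_list :: "real \<Rightarrow> nat \<Rightarrow> real list" where
  "harmonic_list x n = map (\<lambda>k. x / real k) [1..<Suc n]"

lemma quasi_arith_mean_uminus:
  "quasi_arith_mean I (\<lambda>t. - f t) xs = quasi_arith_mean I f xs"
proof -
  have "sum_list (map (\<lambda>t. - f t) xs) = - sum_list (map f xs)"
    by (simp add: uminus_sum_list_map o_def)
  then show ?thesis
    by (simp add: quasi_arith_mean_def the_inv_into_def)
qed

locale increasing_generator =
  fixes I :: "real set" and f f' f'' \<kappa> :: "real \<Rightarrow> real"
  assumes I_interval: "is_interval I" and I_nonempty: "I \<noteq> {}"
    and I_pos: "I \<subseteq> {0<..}" and Inf_I: "Inf I = 0"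
    and deriv_f: "\<And>x. x \<in> I \<Longrightarrow> (f has_real_derivative f' x) (at x within I)"
    and deriv_f': "\<And>x. x \<in> I \<Longrightarrow> (f' has_real_derivative f'' x) (at x within I)"
    and f'_pos: "\<And>x. x \<in> I \<Longrightarrow> 0 < f' x"
    and kappa: "\<And>x. x \<in> I \<Longrightarrow> \<kappa> x = x * f'' x / f' x + 1"
begin

lemma I_down: "t \<in> I \<Longrightarrow> 0 < u \<Longrightarrow> u \<le> t \<Longrightarrow> u \<in> I"
proof -
  assume t: "t \<in> I" and u: "0 < u" "u \<le> t"
  then obtain b where "b \<in> I" "b < u"
    using cInf_lessD[OF I_nonempty, of u] Inf_I by auto
  then show "u \<in> I"
    using mem_is_interval_1_I[OF I_interval _ t, of b u] u by simp
qed

lemma pos_of_I: "t \<in> I \<Longrightarrow> 0 < t"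
  using I_pos by auto

lemma f_strict_mono: "u \<in> I \<Longrightarrow> t \<in> I \<Longrightarrow> u < t \<Longrightarrow> f u < f t"
proof -
  assume ut: "u \<in> I" "t \<in> I" "u < t"
  have sub: "{u..t} \<subseteq> I"
    using mem_is_interval_1_I[OF I_interval ut(1,2)] by auto
  have "\<exists>\<xi>\<in>{u<..<t}. f t - f u = f' \<xi> * (t - u)"
  proof (rule mvt_simple[of u t f "\<lambda>v w. f' v * w"])
    fix v assume "u \<le> v" "v \<le> t"
    then have v: "v \<in> I" using sub by auto
    show "(f has_derivative (\<lambda>w. f' v * w)) (at v within {u..t})"
      using DERIV_subset[OF deriv_f[OF v] sub] by (simp add: has_field_derivative_def)
  qed (use ut in simp)
  then obtain \<xi> where \<xi>: "\<xi> \<in> {u<..<t}" "f t - f u = f' \<xi> * (t - u)" by auto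
  have "0 < f' \<xi>" using \<xi>(1) sub by (intro f'_pos) auto
  then have "0 < f' \<xi> * (t - u)" using ut by simp
  then show "f u < f t" using \<xi>(2) by linarith
qed

lemma f_le_iff: "u \<in> I \<Longrightarrow> t \<in> I \<Longrightarrow> f u \<le> f t \<longleftrightarrow> u \<le> t"
  using f_strict_mono[of u t] f_strict_mono[of t u] by (metis linorder_not_less order_le_less)

lemma f_inj: "inj_on f I"
  using f_le_iff by (intro inj_onI) (metis order_antisym order_refl)

text \<open>The average of the values of \<open>f\<close> lies between its values at the smallest and the largest entry,
  hence in the connected set \<open>f ` I\<close>.\<close>

lemma mean_in_I_and_eq:
  assumes "xs \<noteq> []" "set xs \<subseteq> I"
  shows mean_in_I: "quasi_arith_mean I f xs \<in> I"
    and f_mean: "f (quasi_arith_mean I f xs) = sum_list (map f xs) / real (length xs)"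
proof -
  let ?a = "sum_list (map f xs) / real (length xs)"
  have len: "0 < real (length xs)" using assms by simp
  have mm: "f (Min (set xs)) \<le> f t \<and> f t \<le> f (Max (set xs))" if "t \<in> set xs" for t
    using that assms Min_in[of "set xs"] Max_in[of "set xs"] by (auto simp: f_le_iff subset_iff)
  have "sum_list (map (\<lambda>t. f (Min (set xs))) xs) \<le> sum_list (map f xs)"
    "sum_list (map f xs) \<le> sum_list (map (\<lambda>t. f (Max (set xs))) xs)"
    using mm by (intro sum_list_mono; simp)+
  then have a: "f (Min (set xs)) \<le> ?a" "?a \<le> f (Max (set xs))"
    using len by (simp_all add: sum_list_triv field_simps)
  have "continuous_on I f"
    using deriv_f by (meson DERIV_continuous continuous_on_eq_continuous_within)
  then have "connected (f ` I)"
    using I_interval by (intro connected_continuous_image) (simp_all add: is_interval_connected_1)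
  moreover have "Min (set xs) \<in> I" "Max (set xs) \<in> I"
    using assms Min_in[of "set xs"] Max_in[of "set xs"] by (auto simp: subset_iff)
  then have "f (Min (set xs)) \<in> f ` I" "f (Max (set xs)) \<in> f ` I" by auto
  ultimately have "?a \<in> f ` I" using a connectedD_interval by blast
  then show "quasi_arith_mean I f xs \<in> I" "f (quasi_arith_mean I f xs) = ?a"
    unfolding quasi_arith_mean_def
    using f_inj by (auto simp: f_the_inv_into_f intro: the_inv_into_into)
qed

lemma le_mean_iff:
  assumes "xs \<noteq> []" "set xs \<subseteq> I" "y \<in> I"
  shows "y \<le> quasi_arith_mean I f xs \<longleftrightarrow> real (length xs) * f y \<le> sum_list (map f xs)"
    and "quasi_arith_mean I f xs \<le> y \<longleftrightarrow> sum_list (map f xs) \<le> real (length xs) * f y"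
proof -
  have len: "0 < real (length xs)" using assms by simp
  show "y \<le> quasi_arith_mean I f xs \<longleftrightarrow> real (length xs) * f y \<le> sum_list (map f xs)"
    using f_le_iff[OF assms(3) mean_in_I[OF assms(1,2)]] f_mean[OF assms(1,2)] len
    by (simp add: field_simps)
  show "quasi_arith_mean I f xs \<le> y \<longleftrightarrow> sum_list (map f xs) \<le> real (length xs) * f y"
    using f_le_iff[OF mean_in_I[OF assms(1,2)] assms(3)] f_mean[OF assms(1,2)] len
    by (simp add: field_simps)
qed

lemma harmonic_list_in_I: "x \<in> I \<Longrightarrow> set (harmonic_list x n) \<subseteq> I"
  using pos_of_I by (auto intro!: I_down[of x] simp: harmonic_list_def field_simps simp del: upt_Suc)

lemma sum_list_harmonic: "sum_list (map f (harmonic_list x n)) = (\<Sum>k=1..n. f (x / real k))"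
  by (simp add: harmonic_list_def o_def sum_set_upt_conv_sum_list_nat[symmetric] atLeastLessThanSuc_atLeastAtMost
      interv_sum_list_conv_sum_set_nat del: upt_Suc)

lemma mean_harmonic_list_iff:
  assumes "x \<in> I" "1 \<le> n" "0 < \<theta>" "\<theta> * x / real n \<in> I"
  shows "\<theta> \<le> real n / x * quasi_arith_mean I f (harmonic_list x n)
      \<longleftrightarrow> real n * f (\<theta> * x / real n) \<le> (\<Sum>k=1..n. f (x / real k))"
    and "real n / x * quasi_arith_mean I f (harmonic_list x n) \<le> \<theta>
      \<longleftrightarrow> (\<Sum>k=1..n. f (x / real k)) \<le> real n * f (\<theta> * x / real n)"
proof -
  have ne: "harmonic_list x n \<noteq> []" and len: "length (harmonic_list x n) = n"
    using assms by (auto simp: harmonic_list_def simp del: upt_Suc)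
  note iff = le_mean_iff[OF ne harmonic_list_in_I[OF assms(1)] assms(4), unfolded sum_list_harmonic len]
  have x: "0 < x" "0 < real n" using assms pos_of_I by auto
  then have "\<theta> \<le> real n / x * A \<longleftrightarrow> \<theta> * x / real n \<le> A" "real n / x * A \<le> \<theta> \<longleftrightarrow> A \<le> \<theta> * x / real n" for A
    by (simp_all add: field_simps)
  then show "\<theta> \<le> real n / x * quasi_arith_mean I f (harmonic_list x n)
      \<longleftrightarrow> real n * f (\<theta> * x / real n) \<le> (\<Sum>k=1..n. f (x / real k))"
    and "real n / x * quasi_arith_mean I f (harmonic_list x n) \<le> \<theta>
      \<longleftrightarrow> (\<Sum>k=1..n. f (x / real k)) \<le> real n * f (\<theta> * x / real n)"
    using iff by simp_all
qed

text \<open>The mean is at least its smallest argument \<open>x / n\<close>. This is the whole lower estimate when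
  \<open>C_const q = 1\<close>.\<close>

lemma mean_harmonic_list_ge_1:
  assumes "x \<in> I" "1 \<le> n"
  shows "1 \<le> real n / x * quasi_arith_mean I f (harmonic_list x n)"
proof -
  have x: "0 < x" using assms pos_of_I by auto
  have y: "1 * x / real n \<in> I"
    using assms x by (intro I_down[OF assms(1)]) (auto simp: field_simps)
  have "(\<Sum>k=1..n. f (x / real n)) \<le> (\<Sum>k=1..n. f (x / real k))"
  proof (rule sum_mono)
    fix k assume k: "k \<in> {1..n}"
    then have "x / real k \<in> I" "x / real n \<le> x / real k"
      using x by (auto intro!: I_down[OF assms(1)] simp: field_simps)
    then show "f (x / real n) \<le> f (x / real k)" using y f_le_iff by simp
  qed
  then show ?thesis using mean_harmonic_list_iff(1)[OF assms _ y] by simp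
qed

section \<open>Asymptotic bounds for the means of the harmonic sequence\<close>

lemma eventually_initial_segment:
  assumes "eventually P (at_right 0)"
  obtains \<delta> where "0 < \<delta>" "{0<..<\<delta>} \<subseteq> I" "\<And>t. t \<in> {0<..<\<delta>} \<Longrightarrow> P t"
proof -
  obtain a where a: "a \<in> I" using I_nonempty by auto
  obtain b where b: "b > 0" "\<And>t. 0 < t \<Longrightarrow> t < b \<Longrightarrow> P t"
    using assms by (auto simp: eventually_at_right_field)
  show ?thesis
    by (rule that[of "min a b"]) (use a b pos_of_I[OF a] in \<open>auto intro: I_down\<close>)
qed

lemma deriv_at_interior:
  assumes "{0<..<\<delta>} \<subseteq> I" "t \<in> {0<..<\<delta>}"
  shows "(f has_real_derivative f' t) (at t)" "(f' has_real_derivative f'' t) (at t)"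
proof -
  have "at t within I = at t"
    using assms by (intro at_within_interior interiorI[of "{0<..<\<delta>}"]) auto
  then show "(f has_real_derivative f' t) (at t)" "(f' has_real_derivative f'' t) (at t)"
    using assms deriv_f[of t] deriv_f'[of t] by auto
qed

text \<open>This links the hypotheses on \<open>\<kappa>\<close> to the curvature condition of \<open>power_tangent_bound\<close>: as
  \<open>f'\<close> is positive, the sign of the left-hand side is that of \<open>\<kappa> t - s\<close>.\<close>

lemma curvature_eq:
  assumes "t \<in> I"
  shows "t * f'' t + (1 - s) * f' t = (\<kappa> t - s) * f' t"
  using f'_pos[OF assms] kappa[OF assms] by (simp add: field_simps)

text \<open>The average that the tangent inequality at \<open>y = \<theta> * x / n\<close> produces, when it is evaluated at the
  capped points \<open>x / max k K\<close>.\<close>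

lemma capped_average_limit:
  assumes "s < 1" "s \<noteq> 0" "0 < x" "0 < \<theta>" "1 \<le> K"
  shows "(\<lambda>n. (\<Sum>k=1..n. (((x / real (max k K)) / (\<theta> * x / real n)) powr s - 1)) / s / real n)
      \<longlonglongrightarrow> (\<theta> powr (- s) / (1 - s) - 1) / s"
proof -
  have "(\<lambda>n. (\<theta> powr (- s) * (real n powr (s - 1) * (\<Sum>k=1..n. real (max k K) powr (- s))) - 1) / s)
      \<longlonglongrightarrow> (\<theta> powr (- s) * (1 / (1 - s)) - 1) / s"
    by (intro tendsto_intros capped_powr_sum_limit assms)
  moreover have "\<forall>\<^sub>F n in sequentially.
      (\<theta> powr (- s) * (real n powr (s - 1) * (\<Sum>k=1..n. real (max k K) powr (- s))) - 1) / s
    = (\<Sum>k=1..n. (((x / real (max k K)) / (\<theta> * x / real n)) powr s - 1)) / s / real n"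
    using eventually_gt_at_top[of 0]
  proof eventually_elim
    case (elim n)
    have n: "real n powr s = real n * real n powr (s - 1)"
      using elim powr_add[of "real n" 1 "s - 1"] by simp
    have ratio: "((x / real (max k K)) / (\<theta> * x / real n)) powr s
        = real n * (\<theta> powr (- s) * (real n powr (s - 1) * real (max k K) powr (- s)))" for k
    proof -
      have "0 < real (max k K)" using assms by simp
      moreover have "(x / real (max k K)) / (\<theta> * x / real n) = real n / (\<theta> * real (max k K))"
        using assms by (simp add: field_simps)
      ultimately show ?thesis using assms elim n
        by (simp add: powr_divide powr_mult powr_minus_divide del: of_nat_max)
    qed
    let ?P = "\<theta> powr (- s) * (real n powr (s - 1) * (\<Sum>k=1..n. real (max k K) powr (- s)))"
    have "(\<Sum>k=1..n. (((x / real (max k K)) / (\<theta> * x / real n)) powr s - 1)) = real n * (?P - 1)"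
      unfolding ratio by (simp add: sum_subtractf sum_distrib_left right_diff_distrib del: of_nat_max)
    then show ?case using elim by simp
  qed
  ultimately show ?thesis using tendsto_cong by fastforce
qed

lemma obtain_cap:
  assumes "0 < \<delta>" "0 < (x::real)"
  obtains K :: nat where "1 \<le> K" "x / real K < \<delta>"
proof -
  obtain K where K: "x / \<delta> < real K" using reals_Archimedean2 by blast
  moreover have "0 < x / \<delta>" using assms by simp
  ultimately have "0 < K" by linarith
  then show ?thesis using that[of K] K assms by (simp add: field_simps)
qed

lemma eventually_small:
  assumes "0 < (\<delta>::real)"
  shows "\<forall>\<^sub>F n in sequentially. \<theta> * x / real n < \<delta>"
proof -
  have "(\<lambda>n. \<theta> * x / real n) \<longlonglongrightarrow> 0" by (rule lim_const_over_n)
  then show ?thesis using assms by (rule order_tendstoD)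
qed

text \<open>Lowering the points to \<open>x / max k K\<close> decreases the sum of the values of \<open>f\<close>, and
  the tangent inequality bounds the new sum below by \<open>n * f y\<close> plus a positive multiple of the
  average \<open>a n\<close>, whose limit is positive because \<open>\<theta> < power_mean_const r\<close>.\<close>

lemma eventually_mean_harmonic_list_ge:
  assumes r: "r < 1" "r \<noteq> 0" and \<theta>: "0 < \<theta>" "\<theta> < power_mean_const r"
    and \<kappa>: "\<forall>\<^sub>F t in at_right 0. r \<le> \<kappa> t" and x: "x \<in> I"
  shows "\<forall>\<^sub>F n in sequentially. \<theta> \<le> real n / x * quasi_arith_mean I f (harmonic_list x n)"
proof -
  obtain \<delta> where \<delta>: "0 < \<delta>" "{0<..<\<delta>} \<subseteq> I" "\<And>t. t \<in> {0<..<\<delta>} \<Longrightarrow> r \<le> \<kappa> t"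
    using eventually_initial_segment[OF \<kappa>] by blast
  have x0: "0 < x" using x pos_of_I by simp
  obtain K :: nat where K: "1 \<le> K" "x / real K < \<delta>" using obtain_cap[OF \<delta>(1) x0] .
  define c where "c k = x / real (max k K)" for k
  have c: "c k \<in> {0<..<\<delta>}" "c k \<le> x / real k" if "1 \<le> k" for k
  proof -
    have "c k \<le> x / real K" using K x0 by (auto simp: c_def intro!: divide_left_mono)
    then show "c k \<in> {0<..<\<delta>}" using K x0 by (auto simp: c_def)
    show "c k \<le> x / real k" using that x0 by (auto simp: c_def intro!: divide_left_mono)
  qed
  have curv: "0 \<le> t * f'' t + (1 - r) * f' t" if "t \<in> {0<..<\<delta>}" for t
    using curvature_eq[of t r] f'_pos[of t] \<delta>(2) \<delta>(3)[OF that] that by auto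
  have sub: "{0<..<\<delta>} \<subseteq> {0<..}" by auto
  have tangent: "f y + f' y * y * (((t / y) powr r - 1) / r) \<le> f t"
    if "y \<in> {0<..<\<delta>}" "t \<in> {0<..<\<delta>}" for y t
    using deriv_at_interior[OF \<delta>(2)] curv
    by (rule power_tangent_bound[OF is_interval_oo sub _ _ _ r(2) that])
  define a where "a n = (\<Sum>k=1..n. ((c k / (\<theta> * x / real n)) powr r - 1)) / r / real n" for n
  have "a \<longlonglongrightarrow> (\<theta> powr (- r) / (1 - r) - 1) / r"
    unfolding a_def c_def by (rule capped_average_limit[OF r x0 \<theta>(1) K(1)])
  then have "\<forall>\<^sub>F n in sequentially. 0 < a n"
    using power_mean_const_left[OF r \<theta>] by (rule order_tendstoD)
  then show ?thesis
    using eventually_small[OF \<delta>(1), of \<theta> x] eventually_ge_at_top[of 1]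
  proof eventually_elim
    case (elim n)
    define y where "y = \<theta> * x / real n"
    have y: "y \<in> {0<..<\<delta>}" "y \<in> I" using elim \<theta> x0 \<delta>(2) by (auto simp: y_def)
    have "real n * f y \<le> real n * f y + f' y * y * (real n * a n)"
      using y f'_pos[OF y(2)] elim by simp
    also have "\<dots> = (\<Sum>k=1..n. f y + f' y * y * (((c k / y) powr r - 1) / r))"
      using elim by (simp add: a_def y_def sum.distrib sum_distrib_left[symmetric] sum_divide_distrib[symmetric])
    also have "\<dots> \<le> (\<Sum>k=1..n. f (c k))"
      using tangent[OF y(1)] c by (intro sum_mono) auto
    also have "\<dots> \<le> (\<Sum>k=1..n. f (x / real k))"
    proof (rule sum_mono)
      fix k assume k: "k \<in> {1..n}"
      then have "x / real k \<in> I" using x0 by (auto intro!: I_down[OF x] simp: field_simps)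
      moreover have "c k \<in> I" "c k \<le> x / real k" using c[of k] k \<delta>(2) by auto
      ultimately show "f (c k) \<le> f (x / real k)" by (simp add: f_le_iff)
    qed
    finally show ?case
      using mean_harmonic_list_iff(1)[OF x elim(3) \<theta>(1)] y by (simp add: y_def)
  qed
qed

text \<open>The same argument with reversed inequalities, except that lowering the points now goes in the
  wrong direction and costs \<open>D\<close>, the sum of the decreases of \<open>f\<close>. The average \<open>a n\<close> stays below
  some \<open>- \<eta> < 0\<close>, so the gain is at least \<open>\<eta> * n * y * f' y\<close>. Since \<open>f' t * t powr (1 - s)\<close> is
  nonincreasing near 0, this gain is at least a constant times \<open>n * y powr s\<close>, hence a constant
  times \<open>n powr (1 - s)\<close>, and it eventually exceeds \<open>D\<close>.\<close>

lemma eventually_mean_harmonic_list_le: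
  assumes s: "s < 1" "s \<noteq> 0" and \<theta>: "power_mean_const s < \<theta>"
    and \<kappa>: "\<forall>\<^sub>F t in at_right 0. \<kappa> t \<le> s" and x: "x \<in> I"
  shows "\<forall>\<^sub>F n in sequentially. real n / x * quasi_arith_mean I f (harmonic_list x n) \<le> \<theta>"
proof -
  obtain \<delta> where \<delta>: "0 < \<delta>" "{0<..<\<delta>} \<subseteq> I" "\<And>t. t \<in> {0<..<\<delta>} \<Longrightarrow> \<kappa> t \<le> s"
    using eventually_initial_segment[OF \<kappa>] by blast
  have x0: "0 < x" using x pos_of_I by simp
  have \<theta>0: "0 < \<theta>" using power_mean_const_pos[OF s(1)] \<theta> by simp
  obtain K :: nat where K: "1 \<le> K" "x / real K < \<delta>" using obtain_cap[OF \<delta>(1) x0] .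
  define c where "c k = x / real (max k K)" for k
  have c: "c k \<in> {0<..<\<delta>}" if "1 \<le> k" for k
  proof -
    have "c k \<le> x / real K" using K x0 by (auto simp: c_def intro!: divide_left_mono)
    then show "c k \<in> {0<..<\<delta>}" using K x0 by (auto simp: c_def)
  qed
  have curv: "0 \<le> t * - f'' t + (1 - s) * - f' t" if "t \<in> {0<..<\<delta>}" for t
    using curvature_eq[of t s] f'_pos[of t] \<delta>(2) \<delta>(3)[OF that] that
      mult_nonpos_nonneg[of "\<kappa> t - s" "f' t"] by auto
  have sub: "{0<..<\<delta>} \<subseteq> {0<..}" by auto
  have deriv: "((\<lambda>t. - f t) has_real_derivative - f' t) (at t)"
    "((\<lambda>t. - f' t) has_real_derivative - f'' t) (at t)" if "t \<in> {0<..<\<delta>}" for t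
    using deriv_at_interior[OF \<delta>(2) that] by (auto intro: DERIV_minus)
  have tangent: "f t \<le> f y + f' y * y * (((t / y) powr s - 1) / s)"
    if "y \<in> {0<..<\<delta>}" "t \<in> {0<..<\<delta>}" for y t
  proof -
    have "- f y + - f' y * y * (((t / y) powr s - 1) / s) \<le> - f t"
      using deriv curv by (rule power_tangent_bound[OF is_interval_oo sub _ _ _ s(2) that])
    then show ?thesis by simp
  qed
  define a where "a n = (\<Sum>k=1..n. ((c k / (\<theta> * x / real n)) powr s - 1)) / s / real n" for n
  obtain \<eta> where \<eta>: "0 < \<eta>" "(\<theta> powr (- s) / (1 - s) - 1) / s < - \<eta>"
    using dense[OF power_mean_const_right[OF s \<theta>]] by (metis add.inverse_inverse neg_0_less_iff_less)
  have "a \<longlonglongrightarrow> (\<theta> powr (- s) / (1 - s) - 1) / s"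
    unfolding a_def c_def by (rule capped_average_limit[OF s x0 \<theta>0 K(1)])
  then have ev_a: "\<forall>\<^sub>F n in sequentially. a n < - \<eta>"
    using \<eta>(2) by (rule order_tendstoD)
  define D where "D = (\<Sum>k=1..K. f (x / real k) - f (c k))"
  have cK: "c K \<in> {0<..<\<delta>}" using c K by simp
  define m where "m = f' (c K) * c K powr (1 - s)"
  have m: "0 < m" using cK f'_pos[of "c K"] \<delta>(2) by (auto simp: m_def)
  have "LIM n sequentially. real n powr (1 - s) :> at_top"
    using s by real_asymp
  then have "\<forall>\<^sub>F n in sequentially. D / (m * (\<theta> * x) powr s * \<eta>) \<le> real n powr (1 - s)"
    by (simp add: filterlim_at_top)
  then have ev_D: "\<forall>\<^sub>F n in sequentially. D \<le> m * (\<theta> * x) powr s * real n powr (1 - s) * \<eta>"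
    using m \<eta> \<theta>0 x0 by (simp add: field_simps)
  show ?thesis
    using ev_a ev_D eventually_small[OF cK[THEN greaterThanLessThan_iff[THEN iffD1], THEN conjunct1], of \<theta> x]
      eventually_ge_at_top[of 1] eventually_ge_at_top[of K]
  proof eventually_elim
    case (elim n)
    define y where "y = \<theta> * x / real n"
    have y: "y \<in> {0<..<\<delta>}" "y \<in> I" "y < c K" using elim \<theta>0 x0 \<delta>(2) cK by (auto simp: y_def)
    have y0: "0 < y" "0 < real n" using y elim by auto
    have "- f' y * y powr (1 - s) \<le> - f' (c K) * c K powr (1 - s)"
      using deriv curv by (rule relative_deriv_mono[OF is_interval_oo sub _ _ _ y(1) cK less_imp_le[OF y(3)]])
    then have "m \<le> f' y * y powr (1 - s)" by (simp add: m_def)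
    then have "m * y powr s \<le> f' y * y powr (1 - s) * y powr s" by (rule mult_right_mono) simp
    also have "\<dots> = f' y * y" using y0 by (simp add: powr_add[symmetric] mult.assoc)
    finally have "m * y powr s * real n * \<eta> \<le> f' y * y * real n * \<eta>"
      using \<eta> by (intro mult_right_mono) auto
    moreover have "m * y powr s * real n = m * (\<theta> * x) powr s * real n powr (1 - s)"
      using \<theta>0 x0 y0 by (simp add: y_def powr_divide powr_diff)
    ultimately have D: "D \<le> f' y * y * real n * \<eta>" using elim by simp
    have "(\<Sum>k=1..n. f (x / real k)) = D + (\<Sum>k=1..n. f (c k))"
    proof -
      have "(\<Sum>k=1..n. f (x / real k) - f (c k)) = D"
        unfolding D_def using elim by (intro sum.mono_neutral_right) (auto simp: c_def max_def)
      then show ?thesis by (simp add: sum_subtractf)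
    qed
    also have "\<dots> \<le> D + (\<Sum>k=1..n. f y + f' y * y * (((c k / y) powr s - 1) / s))"
      using tangent[OF y(1)] c by (intro add_left_mono sum_mono) auto
    also have "\<dots> = D + (real n * f y + f' y * y * real n * a n)"
      using elim by (simp add: a_def y_def sum.distrib sum_distrib_left[symmetric] sum_divide_distrib[symmetric])
    also have "\<dots> \<le> real n * f y"
    proof -
      have "f' y * y * real n * a n \<le> f' y * y * real n * - \<eta>"
        using elim y0 f'_pos[OF y(2)] by (intro mult_left_mono) auto
      then show ?thesis using D by simp
    qed
    finally show ?case
      using mean_harmonic_list_iff(2)[OF x elim(4) \<theta>0] y by (simp add: y_def)
  qed
qed

end

section \<open>The Hardy constant\<close>

text \<open>If \<open>H\<close> were a Hardy bound below some \<open>\<theta>\<close> smaller than the lower limit, then testing it on a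
  sequence that starts with \<open>x / 1, \<dots>, x / m\<close> would give
  \<open>\<theta> * (harm m - harm N) \<le> H * (harm m + 2)\<close> with \<open>N\<close> independent of \<open>m\<close>, which fails for
  large \<open>m\<close>. The tail only has to stay in \<open>I\<close> and have a sum bounded independently of \<open>m\<close>;
  the terms of a geometric sequence below \<open>x\<close> do both.\<close>

lemma liminf_mean_harmonic_list_le_hardy_constant:
  assumes x: "0 < x" and I: "\<And>u. 0 < u \<Longrightarrow> u \<le> x \<Longrightarrow> u \<in> I"
    and M_nonneg: "\<And>xs. xs \<noteq> [] \<Longrightarrow> set xs \<subseteq> I \<Longrightarrow> 0 \<le> M xs"
  shows "liminf (\<lambda>n. ereal (real n / x * M (harmonic_list x n))) \<le> hardy_constant I M"
  unfolding hardy_constant_def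
proof (rule Inf_greatest, rule ccontr)
  let ?L = "liminf (\<lambda>n. ereal (real n / x * M (harmonic_list x n)))"
  fix H assume "H \<in> {H. hardy_bound I M H}" and less: "\<not> ?L \<le> H"
  then have H: "hardy_bound I M H" by simp
  obtain \<theta> where \<theta>: "H < ereal \<theta>" "ereal \<theta> < ?L"
    using less ereal_dense2[of H ?L] by (meson not_le)
  obtain h where h: "H = ereal h" "0 \<le> h" "h < \<theta>"
    using H \<theta>(1) by (cases H) (auto simp: hardy_bound_def)
  have "\<forall>\<^sub>F n in sequentially. ereal \<theta> < ereal (real n / x * M (harmonic_list x n))"
    by (rule less_LiminfD[OF \<theta>(2)])
  then obtain N where N: "\<And>n. N \<le> n \<Longrightarrow> \<theta> < real n / x * M (harmonic_list x n)"
    by (auto simp: eventually_sequentially)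
  have bounded: "(\<theta> - h) * harm m \<le> 2 * h + \<theta> * harm N" if "N \<le> m" for m
  proof -
    define z where "z k = (if k < m then x / real (Suc k) else x * (1 / 2) ^ k)" for k
    have z0: "0 < z k" for k using x by (simp add: z_def)
    have zI: "z k \<in> I" for k
      using x power_le_one[of "1 / 2 :: real" k]
      by (intro I z0) (auto simp: z_def field_simps)
    have harm: "(\<Sum>k<n. x / real (Suc k)) = x * harm n" for n
      by (simp add: harm_def sum_distrib_left sum.atLeast1_atMost_eq divide_inverse)
    have "(\<lambda>k. (if k \<in> {..<m} then x / real (Suc k) - x * (1 / 2) ^ k else 0) + x * (1 / 2) ^ k)
        sums ((\<Sum>k<m. x / real (Suc k) - x * (1 / 2) ^ k) + x * (1 / (1 - 1 / 2)))"
      by (intro sums_add sums_If_finite_set sums_mult geometric_sums) auto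
    moreover have "(\<lambda>k. (if k \<in> {..<m} then x / real (Suc k) - x * (1 / 2) ^ k else 0) + x * (1 / 2) ^ k) = z"
      by (auto simp: z_def)
    ultimately have "z sums (x * harm m - (\<Sum>k<m. x * (1 / 2) ^ k) + 2 * x)"
      by (simp only: sum_subtractf harm) (simp add: mult.commute)
    then have "(\<Sum>k. ereal (z k)) = ereal (x * harm m - (\<Sum>k<m. x * (1 / 2) ^ k) + 2 * x)"
      by (intro sums_unique[symmetric]) (simp add: sums_ereal)
    also have "\<dots> \<le> ereal (x * harm m + 2 * x)"
      using x by (simp add: sum_nonneg)
    finally have total: "(\<Sum>k. ereal (z k)) \<le> ereal (x * harm m + 2 * x)" .
    have M: "0 \<le> M (map z [0..<Suc n])" for n
      using zI by (intro M_nonneg) auto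
    \<comment> \<open>Sequences are indexed from 0, so for \<open>n < m\<close> the first \<open>n + 1\<close> terms are \<open>x / 1, \<dots>, x / (n + 1)\<close>.\<close>
    have prefix: "\<theta> * (x / real (Suc n)) \<le> M (map z [0..<Suc n])" if "n \<in> {N..<m}" for n
    proof -
      have "map z [0..<Suc n] = map (\<lambda>k. x / real (Suc k)) [0..<Suc n]"
        using that by (auto simp: z_def simp del: upt_Suc)
      also have "\<dots> = harmonic_list x (Suc n)"
        by (simp add: harmonic_list_def map_Suc_upt[symmetric] o_def del: upt_Suc)
      finally show ?thesis
        using N[of "Suc n"] that x by (simp add: field_simps del: upt_Suc)
    qed
    have "(\<Sum>n<m. x / real (Suc n)) = (\<Sum>n<N. x / real (Suc n)) + (\<Sum>n\<in>{N..<m}. x / real (Suc n))"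
      using \<open>N \<le> m\<close> by (simp add: lessThan_atLeast0 sum.atLeastLessThan_concat)
    then have "\<theta> * (x * harm m - x * harm N) = (\<Sum>n\<in>{N..<m}. \<theta> * (x / real (Suc n)))"
      unfolding harm sum_distrib_left[symmetric] by simp
    also have "\<dots> \<le> (\<Sum>n\<in>{N..<m}. M (map z [0..<Suc n]))"
      using prefix by (rule sum_mono)
    also have "\<dots> \<le> (\<Sum>n<m. M (map z [0..<Suc n]))"
      using M by (intro sum_mono2) auto
    finally have "ereal (\<theta> * (x * harm m - x * harm N)) \<le> (\<Sum>n<m. ereal (M (map z [0..<Suc n])))"
      by (simp del: upt_Suc)
    also have "\<dots> \<le> (\<Sum>n. ereal (M (map z [0..<Suc n])))"
      by (rule sum_le_suminf) (use M in \<open>auto intro!: summable_ereal_pos simp del: upt_Suc\<close>)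
    also have "\<dots> \<le> H * (\<Sum>n. ereal (z n))"
      using H zI unfolding hardy_bound_def by blast
    also have "\<dots> \<le> H * ereal (x * harm m + 2 * x)"
      using total h by (intro ereal_mult_left_mono) auto
    finally have "\<theta> * (x * harm m - x * harm N) \<le> h * (x * harm m + 2 * x)"
      using h by simp
    then have "x * ((\<theta> - h) * harm m) \<le> x * (2 * h + \<theta> * harm N)"
      by (simp add: algebra_simps)
    then show ?thesis using x by simp
  qed
  have "\<forall>\<^sub>F m in sequentially. (2 * h + \<theta> * harm N) / (\<theta> - h) < harm m"
    using harm_at_top unfolding filterlim_at_top_dense by blast
  then obtain m where m: "N \<le> m" "(2 * h + \<theta> * harm N) / (\<theta> - h) < harm m"
    unfolding eventually_sequentially by (meson nle_le)
  then show False using bounded[OF m(1)] h by (simp add: field_simps)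
qed

section \<open>Comparison with the limits of the relative curvature\<close>

context increasing_generator
begin

lemma C_const_le_liminf_mean_harmonic_list:
  assumes x: "x \<in> I"
  shows "C_const (Liminf (at_right 0) (\<lambda>t. ereal (\<kappa> t)))
    \<le> liminf (\<lambda>n. ereal (real n / x * quasi_arith_mean I f (harmonic_list x n)))"
    (is "C_const ?q \<le> ?L")
proof (rule ccontr)
  assume "\<not> C_const ?q \<le> ?L"
  then obtain \<theta> where \<theta>: "?L < ereal \<theta>" "ereal \<theta> < C_const ?q"
    using ereal_dense2[of ?L "C_const ?q"] by (meson not_le)
  have "\<forall>\<^sub>F n in sequentially. (1::ereal) \<le> ereal (real n / x * quasi_arith_mean I f (harmonic_list x n))"
    using eventually_ge_at_top[of 1]
    by eventually_elim (use mean_harmonic_list_ge_1[OF x] in \<open>simp add: one_ereal_def\<close>)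
  then have "1 \<le> ?L" by (rule Liminf_bounded)
  then have "1 \<le> \<theta>" using \<theta>(1) by (metis ereal_less_eq(3) one_ereal_def order_le_less_trans order_less_imp_le)
  then obtain r where r: "r < 1" "r \<noteq> 0" "ereal r < ?q" "\<theta> < power_mean_const r"
    using less_C_constD[OF \<theta>(2)] by blast
  have "\<forall>\<^sub>F t in at_right 0. r \<le> \<kappa> t"
    using less_LiminfD[OF r(3)] by eventually_elim simp
  then have "\<forall>\<^sub>F n in sequentially. \<theta> \<le> real n / x * quasi_arith_mean I f (harmonic_list x n)"
    using eventually_mean_harmonic_list_ge[OF r(1,2) _ r(4) _ x] \<open>1 \<le> \<theta>\<close> by simp
  then have "ereal \<theta> \<le> ?L" by (intro Liminf_bounded) simp
  then show False using \<theta>(1) by simp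
qed

lemma limsup_mean_harmonic_list_le_C_const:
  assumes x: "x \<in> I"
  shows "limsup (\<lambda>n. ereal (real n / x * quasi_arith_mean I f (harmonic_list x n)))
    \<le> C_const (Limsup (at_right 0) (\<lambda>t. ereal (\<kappa> t)))"
    (is "?L \<le> C_const ?p")
proof (rule ccontr)
  assume "\<not> ?L \<le> C_const ?p"
  then obtain \<theta> where \<theta>: "ereal \<theta> < ?L" "C_const ?p < ereal \<theta>"
    using ereal_dense2[of "C_const ?p" ?L] by (meson not_le)
  obtain s where s: "s < 1" "s \<noteq> 0" "?p < ereal s" "power_mean_const s < \<theta>"
    using C_const_lessD[OF \<theta>(2)] by blast
  have "\<forall>\<^sub>F t in at_right 0. \<kappa> t \<le> s"
    using Limsup_lessD[OF s(3)] by eventually_elim simp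
  then have "\<forall>\<^sub>F n in sequentially. real n / x * quasi_arith_mean I f (harmonic_list x n) \<le> \<theta>"
    by (rule eventually_mean_harmonic_list_le[OF s(1,2,4) _ x])
  then have "?L \<le> ereal \<theta>" by (intro Limsup_bounded) simp
  then show False using \<theta>(1) by simp
qed

lemma liminf_mean_harmonic_list_le_hardy_constant_quasi_arith_mean:
  assumes x: "x \<in> I"
  shows "liminf (\<lambda>n. ereal (real n / x * quasi_arith_mean I f (harmonic_list x n)))
    \<le> hardy_constant I (quasi_arith_mean I f)"
  using pos_of_I[OF x] I_down[OF x] mean_in_I pos_of_I
  by (intro liminf_mean_harmonic_list_le_hardy_constant) (auto intro: less_imp_le)

end

theorem theorem3p1:
  fixes I :: "real set" and f f' f'' \<kappa> :: "real \<Rightarrow> real" and p q :: ereal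
  assumes "is_interval I" and "I \<noteq> {}" and "I \<subseteq> {0<..}" and "Inf I = 0"
    and "\<And>x. x \<in> I \<Longrightarrow> (f has_real_derivative f' x) (at x within I)"
    and "\<And>x. x \<in> I \<Longrightarrow> (f' has_real_derivative f'' x) (at x within I)"
    and "continuous_on I f''"
    and "\<And>x. x \<in> I \<Longrightarrow> f' x \<noteq> 0"
    and "\<And>x. x \<in> I \<Longrightarrow> \<kappa> x = x * f'' x / f' x + 1"
    and "q = Liminf (at_right 0) (\<lambda>x. ereal (\<kappa> x))"
    and "p = Limsup (at_right 0) (\<lambda>x. ereal (\<kappa> x))"
  shows "q \<le> p \<and>
    (\<forall>x\<in>I.
       C_const q
         \<le> liminf (\<lambda>n. ereal (real n / x * quasi_arith_mean I f (map (\<lambda>k. x / real k) [1..<Suc n]))) \<and>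
       liminf (\<lambda>n. ereal (real n / x * quasi_arith_mean I f (map (\<lambda>k. x / real k) [1..<Suc n])))
         \<le> limsup (\<lambda>n. ereal (real n / x * quasi_arith_mean I f (map (\<lambda>k. x / real k) [1..<Suc n]))) \<and>
       limsup (\<lambda>n. ereal (real n / x * quasi_arith_mean I f (map (\<lambda>k. x / real k) [1..<Suc n])))
         \<le> C_const p) \<and>
    C_const q \<le> hardy_constant I (quasi_arith_mean I f)"
proof -
  \<comment> \<open>Without zeros on the interval, \<open>f'\<close> has constant sign; if it is negative, take \<open>g = - f\<close>.\<close>
  have "\<exists>g g' g''. increasing_generator I g g' g'' \<kappa> \<and> quasi_arith_mean I g = quasi_arith_mean I f"
  proof (cases "\<forall>x\<in>I. 0 < f' x")
    case True
    then have "increasing_generator I f f' f'' \<kappa>"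
      using assms by unfold_locales auto
    then show ?thesis by blast
  next
    case False
    then obtain a where a: "a \<in> I" "f' a < 0" using assms(8) by force
    have "continuous_on I f'"
      using assms(6) by (meson DERIV_continuous continuous_on_eq_continuous_within)
    then have conn: "connected (f' ` I)"
      using assms(1) by (intro connected_continuous_image) (simp_all add: is_interval_connected_1)
    have neg: "f' x < 0" if "x \<in> I" for x
    proof (rule ccontr)
      assume "\<not> f' x < 0"
      then have "0 \<in> f' ` I"
        using connectedD_interval[OF conn, of "f' a" "f' x" 0] a that by simp
      then show False using assms(8) by auto
    qed
    have "increasing_generator I (\<lambda>x. - f x) (\<lambda>x. - f' x) (\<lambda>x. - f'' x) \<kappa>"
      using assms neg by unfold_locales (auto intro!: DERIV_minus)
    moreover have "quasi_arith_mean I (\<lambda>x. - f x) = quasi_arith_mean I f"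
      by (intro ext quasi_arith_mean_uminus)
    ultimately show ?thesis by blast
  qed
  then obtain g g' g'' where g: "increasing_generator I g g' g'' \<kappa>"
    and mean: "quasi_arith_mean I g = quasi_arith_mean I f"
    by blast
  note lower = increasing_generator.C_const_le_liminf_mean_harmonic_list[OF g, unfolded mean, folded assms(10)]
  note upper = increasing_generator.limsup_mean_harmonic_list_le_C_const[OF g, unfolded mean, folded assms(11)]
  note hardy = increasing_generator.liminf_mean_harmonic_list_le_hardy_constant_quasi_arith_mean[OF g, unfolded mean]
  obtain a where "a \<in> I" using assms(2) by auto
  then have "C_const q \<le> hardy_constant I (quasi_arith_mean I f)"
    using order_trans[OF lower hardy] by blast
  moreover have "q \<le> p"
    unfolding assms(10,11) by (rule Liminf_le_Limsup) simp
  ultimately show ?thesis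
    unfolding harmonic_list_def[symmetric]
    using lower upper by (auto intro!: Liminf_le_Limsup)
qed

end
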